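(* Let $A \in \mathbb{R}^{n \times n}$ be symmetric with non-negative entries and $\|A\| \le 1$. Let $B \in \mathbb{R}^{n \times n}$ be symmetric with $|B_{ij}| \le A_{ij}$ for all $i,j$. Let $0<\tau<1$ and suppose $\mathrm{rank}_{\ge \tau}(A) \le s$. Then for any $\sigma > 0$, \[ \mathrm{rank}_{\ge \sqrt{\tau(1-\sigma) + \sigma}}(B) \le \frac{s}{\sigma^2}. \]
   Context: $\|A\|$ denotes the operator norm. For a symmetric matrix $B$ and a threshold $\lambda$, $\mathrm{rank}_{\ge \lambda}(B)$ is the number of eigenvalues of $B$ (counted with multiplicity) that are at least $\lambda$. *)

theory Defs
  imports Complex_Main "Jordan_Normal_Form.Char_Poly"
begin

definition vec_l2norm :: "real vec \<Rightarrow> real" where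
  "vec_l2norm v = sqrt (v \<bullet> v)"

text \<open>The operator norm with respect to the Euclidean norms. The set below always contains 0 and
  is bounded above (see \<open>bdd_above_op_norm\<close>), so the supremum is a genuine one.\<close>

definition op_norm :: "real mat \<Rightarrow> real" where
  "op_norm A = Sup {vec_l2norm (A *\<^sub>v v) | v. v \<in> carrier_vec (dim_col A) \<and> vec_l2norm v \<le> 1}"

text \<open>Multiplicity is algebraic multiplicity, i.e. the order as a root of the characteristic
  polynomial. For a square matrix the index set of the sum is finite
  (see \<open>finite_eigenvalues_ge\<close>).\<close>

definition rank_ge :: "real \<Rightarrow> real mat \<Rightarrow> nat" where
  "rank_ge l B = (\<Sum>x | eigenvalue B x \<and> l \<le> x. order x (char_poly B))"

lemma finite_eigenvalues_ge:
  fixes B :: "real mat"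
  assumes B: "B \<in> carrier_mat n n"
  shows "finite {x. eigenvalue B x \<and> l \<le> x}"
proof -
  have "char_poly B \<noteq> 0"
    using degree_monic_char_poly[OF B] by auto
  then have "finite {x. poly (char_poly B) x = 0}"
    by (rule poly_roots_finite)
  then show ?thesis
    by (rule rev_finite_subset) (auto simp: eigenvalue_root_char_poly[OF B])
qed

lemma bdd_above_op_norm:
  "bdd_above {vec_l2norm (A *\<^sub>v v) | v. v \<in> carrier_vec (dim_col A) \<and> vec_l2norm v \<le> 1}"
proof (rule bdd_aboveI)
  fix y
  assume "y \<in> {vec_l2norm (A *\<^sub>v v) | v. v \<in> carrier_vec (dim_col A) \<and> vec_l2norm v \<le> 1}"
  then obtain v where v: "v \<in> carrier_vec (dim_col A)" and le: "vec_l2norm v \<le> 1"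
    and y: "y = vec_l2norm (A *\<^sub>v v)"
    by auto
  have sum_le: "(\<Sum>j<dim_col A. (v $ j)\<^sup>2) \<le> 1"
    using le v by (simp add: vec_l2norm_def scalar_prod_def power2_eq_square atLeast0LessThan)
  have comp: "\<bar>v $ j\<bar> \<le> 1" if "j < dim_col A" for j
  proof -
    have "(v $ j)\<^sup>2 \<le> (\<Sum>j<dim_col A. (v $ j)\<^sup>2)"
      using that by (intro member_le_sum) auto
    with sum_le have "(v $ j)\<^sup>2 \<le> 1" by linarith
    then show ?thesis by (simp add: abs_square_le_1)
  qed
  have row: "\<bar>(A *\<^sub>v v) $ i\<bar> \<le> (\<Sum>j<dim_col A. \<bar>A $$ (i,j)\<bar>)" if i: "i < dim_row A" for i
  proof -
    have "(A *\<^sub>v v) $ i = (\<Sum>j<dim_col A. A $$ (i,j) * v $ j)"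
      using i v by (simp add: scalar_prod_def atLeast0LessThan)
    also have "\<bar>\<dots>\<bar> \<le> (\<Sum>j<dim_col A. \<bar>A $$ (i,j) * v $ j\<bar>)"
      by (rule sum_abs)
    also have "\<dots> \<le> (\<Sum>j<dim_col A. \<bar>A $$ (i,j)\<bar>)"
      by (intro sum_mono) (use comp in \<open>auto simp: abs_mult intro: mult_left_le\<close>)
    finally show ?thesis .
  qed
  have "(A *\<^sub>v v) \<bullet> (A *\<^sub>v v) = (\<Sum>i<dim_row A. ((A *\<^sub>v v) $ i)\<^sup>2)"
    unfolding scalar_prod_def dim_mult_mat_vec power2_eq_square atLeast0LessThan ..
  also have "\<dots> \<le> (\<Sum>i<dim_row A. (\<Sum>j<dim_col A. \<bar>A $$ (i,j)\<bar>)\<^sup>2)"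
    by (intro sum_mono) (metis row lessThan_iff abs_ge_zero power2_abs power_mono)
  finally show "y \<le> sqrt (\<Sum>i<dim_row A. (\<Sum>j<dim_col A. \<bar>A $$ (i,j)\<bar>)\<^sup>2)"
    by (simp add: y vec_l2norm_def)
qed

end

theory Submission
  imports Defs "Jordan_Normal_Form.Spectral_Radius" "HOL-Analysis.Convex"
begin

text \<open>Let \<open>m\<close> orthonormal eigenvectors of \<open>B\<close> have eigenvalue at least
  \<open>\<mu> = sqrt (\<tau> (1 - \<sigma>) + \<sigma>)\<close>, and let \<open>u\<^sub>i \<in> \<real>\<^sup>m\<close> be the vectors of their \<open>i\<close>-th coordinates.
  The squared correlations \<open>X\<^sub>i\<^sub>j = \<langle>u\<^sub>i, u\<^sub>j\<rangle>\<^sup>2 / (\<parallel>u\<^sub>i\<parallel> \<parallel>u\<^sub>j\<parallel>)\<close> form a positive semidefinite matrix of trace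
  \<open>m\<close> and squared Frobenius norm at most \<open>m\<close>. Squaring removes the signs of \<open>B\<close>: since
  \<open>\<mu> m \<le> \<Sum> A\<^sub>i\<^sub>j \<bar>\<langle>u\<^sub>i, u\<^sub>j\<rangle>\<bar>\<close> and \<open>\<Sum> A\<^sub>i\<^sub>j \<parallel>u\<^sub>i\<parallel> \<parallel>u\<^sub>j\<parallel> \<le> m\<close>, Cauchy--Schwarz gives
  \<open>\<mu>\<^sup>2 m \<le> \<langle>A, X\<rangle>\<close>. If \<open>Q\<close> is the projection onto the eigenspaces of \<open>A\<close> with eigenvalue at least \<open>\<tau>\<close>,
  then \<open>\<langle>A, X\<rangle> \<le> \<tau> m + (1 - \<tau>) \<langle>Q, X\<rangle>\<close>, so \<open>\<sigma> m \<le> \<langle>Q, X\<rangle>\<close>, while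
  \<open>\<langle>Q, X\<rangle>\<^sup>2 \<le> (rank Q) m\<close> by Cauchy--Schwarz again.\<close>

section \<open>The spectral theorem for real symmetric matrices\<close>

text \<open>Over the complex numbers an eigenvector \<open>w\<close> exists. By symmetry its
  Hermitian form \<open>H\<close> is its own conjugate, and \<open>H\<close> is \<open>z\<close>
  times the positive number \<open>N\<close>, so \<open>z\<close> is real.\<close>

lemma symmetric_real_eigenvalue_exists:
  fixes A :: "real mat"
  assumes A: "A \<in> carrier_mat n n" and sym: "transpose_mat A = A" and n: "n > 0"
  shows "\<exists>x. eigenvalue A x"
proof -
  define C where "C = map_mat complex_of_real A"
  have C: "C \<in> carrier_mat n n" using A by (simp add: C_def)
  obtain z where z: "eigenvalue C z"
    using spectrum_non_empty[OF C n] by (auto simp: spectrum_def)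
  then obtain w where w: "w \<in> carrier_vec n" "w \<noteq> 0\<^sub>v n" "C *\<^sub>v w = z \<cdot>\<^sub>v w"
    using C by (auto simp: eigenvalue_def eigenvector_def)
  have sym': "A $$ (i,j) = A $$ (j,i)" if "i < n" "j < n" for i j
    using arg_cong[OF sym, of "\<lambda>M. M $$ (i,j)"] that A by simp
  have row: "(\<Sum>j<n. of_real (A $$ (i,j)) * w $ j) = z * w $ i" if "i < n" for i
    using arg_cong[OF w(3), of "\<lambda>v. v $ i"] that w(1) A
    by (simp add: C_def scalar_prod_def atLeast0LessThan)
  define N where "N = (\<Sum>i<n. (cmod (w $ i))\<^sup>2)"
  define H where "H = (\<Sum>i<n. \<Sum>j<n. of_real (A $$ (i,j)) * w $ j * cnj (w $ i))"
  have "H = (\<Sum>i<n. (\<Sum>j<n. of_real (A $$ (i,j)) * w $ j) * cnj (w $ i))"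
    by (simp add: H_def sum_distrib_right)
  also have "\<dots> = (\<Sum>i<n. z * of_real ((cmod (w $ i))\<^sup>2))"
    by (rule sum.cong) (simp_all add: row mult.assoc complex_norm_square del: of_real_power)
  also have "\<dots> = z * of_real N" by (simp add: N_def sum_distrib_left)
  finally have H: "H = z * of_real N" .
  have "cnj H = (\<Sum>i<n. \<Sum>j<n. of_real (A $$ (i,j)) * cnj (w $ j) * w $ i)"
    by (simp add: H_def)
  also have "\<dots> = (\<Sum>j<n. \<Sum>i<n. of_real (A $$ (i,j)) * cnj (w $ j) * w $ i)"
    by (rule sum.swap)
  also have "\<dots> = H"
    unfolding H_def by (intro sum.cong refl) (simp add: sym' mult.commute mult.left_commute)
  finally have HH: "cnj H = H" .
  obtain k where k: "k < n" "w $ k \<noteq> 0"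
    using w(1,2) by (metis carrier_vecD eq_vecI index_zero_vec)
  have "0 < N" unfolding N_def
    by (rule sum_pos2[of _ k]) (use k in auto)
  then have "cnj z = z" using HH by (simp add: H)
  then have zr: "z = of_real (Re z)" by (simp add: complex_eq_iff)
  \<comment> \<open>The characteristic polynomial has the same coefficients for \<open>A\<close> and
    \<open>C\<close>, so the real root descends to \<open>A\<close> without extracting a real
    eigenvector from \<open>w\<close>.\<close>
  have "poly (char_poly C) z = 0"
    using z eigenvalue_root_char_poly[OF C] by simp
  then have "poly (map_poly of_real (char_poly A)) (complex_of_real (Re z)) = 0"
    using zr by (simp add: C_def of_real_hom.char_poly_hom[OF A])
  then have "poly (char_poly A) (Re z) = 0" by simp
  then show ?thesis using eigenvalue_root_char_poly[OF A] by auto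
qed

section \<open>Orthogonal matrices, Householder reflections and diagonalisation\<close>

definition real_orthogonal :: "nat \<Rightarrow> real mat \<Rightarrow> bool" where
  "real_orthogonal n P \<longleftrightarrow> P \<in> carrier_mat n n \<and> P * transpose_mat P = 1\<^sub>m n"

lemma real_orthogonalD:
  assumes "real_orthogonal n P"
  shows "P \<in> carrier_mat n n" "P * transpose_mat P = 1\<^sub>m n" "transpose_mat P * P = 1\<^sub>m n"
  using assms mat_mult_left_right_inverse[of P n "transpose_mat P"]
  by (auto simp: real_orthogonal_def)

lemma real_orthogonal_mult:
  assumes "real_orthogonal n P" "real_orthogonal n Q"
  shows "real_orthogonal n (P * Q)"
proof -
  note P = real_orthogonalD[OF assms(1)] and Q = real_orthogonalD[OF assms(2)]
  have PT: "transpose_mat P \<in> carrier_mat n n" and QT: "transpose_mat Q \<in> carrier_mat n n"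
    using P Q by auto
  have "P * Q * transpose_mat (P * Q) = P * Q * (transpose_mat Q * transpose_mat P)"
    by (simp add: transpose_mult[OF P(1) Q(1)])
  also have "\<dots> = P * (Q * transpose_mat Q) * transpose_mat P"
    using P(1) Q(1) PT QT by (simp add: assoc_mult_mat[of _ n n _ n _ n])
  also have "\<dots> = 1\<^sub>m n" using P Q by simp
  finally show ?thesis using P Q by (auto simp: real_orthogonal_def)
qed

lemma real_orthogonal_with_first_column:
  fixes v :: "real vec"
  assumes v: "v \<in> carrier_vec n" and unit: "v \<bullet> v = 1" and n: "n > 0"
  shows "\<exists>U. real_orthogonal n U \<and> U *\<^sub>v unit_vec n 0 = v"
proof (cases "v = unit_vec n 0")
  case True
  then show ?thesis by (intro exI[of _ "1\<^sub>m n"]) (auto simp: real_orthogonal_def)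
next
  case False
  \<comment> \<open>Householder reflection exchanging \<open>v\<close> and the first unit vector\<close>
  define w where "w i = v $ i - (if i = 0 then 1 else 0)" for i
  define c where "c = (\<Sum>i<n. (w i)\<^sup>2)"
  have v2: "(\<Sum>i<n. (v $ i)\<^sup>2) = 1"
    using unit v by (simp add: scalar_prod_def atLeast0LessThan power2_eq_square)
  \<comment> \<open>Unit length of \<open>v\<close> makes the squared norm \<open>c\<close> of
    \<open>w\<close> linear in \<open>w 0\<close>. This turns the first column of the reflection
    into the first unit vector plus \<open>w\<close>, which is \<open>v\<close>.\<close>
  have "c = (\<Sum>i<n. (v $ i)\<^sup>2 - 2 * (if i = 0 then v $ i else 0) + (if i = 0 then 1 else 0))"
    unfolding c_def by (rule sum.cong) (auto simp: w_def power2_eq_square algebra_simps)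
  also have "\<dots> = 2 - 2 * v $ 0"
    using n by (simp add: sum.distrib sum_subtractf v2 flip: sum_distrib_left)
  finally have c: "c = - 2 * w 0" by (simp add: w_def)
  have c0: "c \<noteq> 0"
  proof
    assume "c = 0"
    then have "\<forall>i<n. w i = 0" by (simp add: c_def sum_nonneg_eq_0_iff)
    then have "v = unit_vec n 0" using v n by (intro eq_vecI) (auto simp: w_def split: if_splits)
    with False show False ..
  qed
  define U where "U = mat n n (\<lambda>(i,j). (if i = j then 1 else 0) - 2 * w i * w j / c)"
  have U: "U \<in> carrier_mat n n" by (simp add: U_def)
  have "(\<Sum>k<n. ((if i = k then 1 else 0) - 2 * w i * w k / c) *
          ((if j = k then 1 else 0) - 2 * w j * w k / c)) = (if i = j then 1 else 0)"
    if "i < n" "j < n" for i j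
  proof -
    have "(\<Sum>k<n. ((if i = k then 1 else 0) - 2 * w i * w k / c) *
          ((if j = k then 1 else 0) - 2 * w j * w k / c))
       = (\<Sum>k<n. (if k = i then (if i = j then 1 else 0) else 0)
           - (if k = i then 2 * w i * w j / c else 0) - (if k = j then 2 * w i * w j / c else 0)
           + 4 * w i * w j / c\<^sup>2 * (w k)\<^sup>2)"
      by (rule sum.cong) (auto simp: power2_eq_square algebra_simps)
    also have "\<dots> = (if i = j then 1 else 0) - 4 * w i * w j / c + 4 * w i * w j / c\<^sup>2 * c"
      using that by (simp add: sum.distrib sum_subtractf flip: sum_distrib_left c_def
          del: times_divide_eq_left)
    also have "\<dots> = (if i = j then 1 else 0)" using c0 by (simp add: power2_eq_square)
    finally show ?thesis .
  qed
  then have "U * transpose_mat U = 1\<^sub>m n"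
    by (intro eq_matI) (auto simp: U_def scalar_prod_def atLeast0LessThan)
  moreover have "U *\<^sub>v unit_vec n 0 = v"
  proof (rule eq_vecI)
    fix i assume "i < dim_vec v"
    then have i: "i < n" using v by simp
    have "(U *\<^sub>v unit_vec n 0) $ i = (if i = 0 then 1 else 0) - 2 * w i * w 0 / c"
      using i n U by (simp add: U_def)
    also have "\<dots> = (if i = 0 then 1 else 0) + w i" using c c0 by (simp add: field_simps)
    finally show "(U *\<^sub>v unit_vec n 0) $ i = v $ i" by (simp add: w_def)
  qed (use U v in auto)
  ultimately show ?thesis using U by (auto simp: real_orthogonal_def)
qed

text \<open>Deflation by induction on the dimension: in an orthonormal basis starting with a unit
  eigenvector, symmetry clears the first row along with the first column, and the remaining block is
  again symmetric.\<close>

theorem symmetric_real_spectral_decomposition: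
  fixes A :: "real mat"
  assumes "A \<in> carrier_mat n n" "transpose_mat A = A"
  shows "\<exists>P D. real_orthogonal n P \<and> D \<in> carrier_mat n n \<and> diagonal_mat D \<and>
           A = P * D * transpose_mat P"
  using assms
proof (induction n arbitrary: A)
  case 0
  then show ?case
    by (intro exI[of _ "1\<^sub>m 0"] exI[of _ A]) (auto simp: real_orthogonal_def diagonal_mat_def)
next
  case (Suc n)
  let ?N = "Suc n"
  note A = Suc.prems(1)
  obtain e x where x: "x \<in> carrier_vec ?N" "x \<noteq> 0\<^sub>v ?N" "A *\<^sub>v x = e \<cdot>\<^sub>v x"
    using symmetric_real_eigenvalue_exists[OF Suc.prems] A
    by (auto simp: eigenvalue_def eigenvector_def)
  have xx: "x \<bullet> x > 0"
    using x(1,2) conjugate_square_greater_0_vec[of x ?N] by simp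
  define v where "v = (1 / sqrt (x \<bullet> x)) \<cdot>\<^sub>v x"
  have v: "v \<in> carrier_vec ?N" using x by (simp add: v_def)
  have vv: "v \<bullet> v = 1" using x xx by (simp add: v_def field_simps)
  have Av: "A *\<^sub>v v = e \<cdot>\<^sub>v v"
    unfolding v_def using A x by (simp add: mult_mat_vec smult_smult_assoc mult.commute)
  obtain U where U: "real_orthogonal ?N U" and Ue: "U *\<^sub>v unit_vec ?N 0 = v"
    using real_orthogonal_with_first_column[OF v vv] by auto
  note U' = real_orthogonalD[OF U]
  have UT: "transpose_mat U \<in> carrier_mat ?N ?N" using U' by auto
  define A' where "A' = transpose_mat U * A * U"
  have A': "A' \<in> carrier_mat ?N ?N" using U' A by (auto simp: A'_def)
  have symA': "transpose_mat A' = A'"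
    unfolding A'_def using U'(1) A UT Suc.prems(2)
    by (simp add: transpose_mult[of _ ?N ?N _ ?N] assoc_mult_mat[of _ ?N ?N _ ?N _ ?N])
  have AA': "A = U * A' * transpose_mat U"
  proof -
    have "U * A' * transpose_mat U = (U * transpose_mat U) * A * (U * transpose_mat U)"
      unfolding A'_def using U'(1) A UT by (simp add: assoc_mult_mat[of _ ?N ?N _ ?N _ ?N])
    then show ?thesis using U' A by simp
  qed
  have "A' *\<^sub>v unit_vec ?N 0 = transpose_mat U *\<^sub>v (A *\<^sub>v (U *\<^sub>v unit_vec ?N 0))"
    unfolding A'_def using U' A UT
    by (simp add: assoc_mult_mat_vec[of _ ?N ?N _ ?N])
  also have "\<dots> = e \<cdot>\<^sub>v (transpose_mat U *\<^sub>v (U *\<^sub>v unit_vec ?N 0))"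
    unfolding Ue Av using UT v by (simp add: mult_mat_vec)
  also have "\<dots> = e \<cdot>\<^sub>v unit_vec ?N 0"
    using U' UT by (simp flip: assoc_mult_mat_vec[of _ ?N ?N _ ?N])
  finally have col0: "A' *\<^sub>v unit_vec ?N 0 = e \<cdot>\<^sub>v unit_vec ?N 0" .
  have A'0: "A' $$ (i,0) = (if i = 0 then e else 0)" if "i < ?N" for i
    using arg_cong[OF col0, of "\<lambda>v. v $ i"] that A' by simp
  have symA'': "A' $$ (i,j) = A' $$ (j,i)" if "i < ?N" "j < ?N" for i j
    using arg_cong[OF symA', of "\<lambda>M. M $$ (i,j)"] that A' by simp
  define A4 where "A4 = mat n n (\<lambda>(i,j). A' $$ (Suc i, Suc j))"
  define E where "E = mat 1 1 (\<lambda>_. e)"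
  have E: "E \<in> carrier_mat 1 1" and A4: "A4 \<in> carrier_mat n n" by (auto simp: E_def A4_def)
  \<comment> \<open>\<open>A'0\<close> describes the first column and, through
    \<open>symA''\<close>, the first row.\<close>
  have blk: "A' = four_block_mat E (0\<^sub>m 1 n) (0\<^sub>m n 1) A4"
  proof (rule eq_matI)
    fix i j assume ij: "i < dim_row (four_block_mat E (0\<^sub>m 1 n) (0\<^sub>m n 1) A4)"
      "j < dim_col (four_block_mat E (0\<^sub>m 1 n) (0\<^sub>m n 1) A4)"
    then have ij': "i < ?N" "j < ?N" using E A4 by auto
    show "A' $$ (i,j) = four_block_mat E (0\<^sub>m 1 n) (0\<^sub>m n 1) A4 $$ (i,j)"
      using ij' A'0[of i] A'0[of j] symA''[of i j] E A4
      by (cases i; cases j) (auto simp: E_def A4_def)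
  qed (use A' E A4 in auto)
  have "transpose_mat A4 = A4"
    by (rule eq_matI) (auto simp: A4_def symA'')
  from Suc.IH[OF A4 this] obtain P D where P: "real_orthogonal n P"
    and D: "D \<in> carrier_mat n n" "diagonal_mat D" and A4eq: "A4 = P * D * transpose_mat P"
    by blast
  note P' = real_orthogonalD[OF P]
  have PT: "transpose_mat P \<in> carrier_mat n n" using P' by auto
  \<comment> \<open>The extension of \<open>P\<close> fixes the first axis, where \<open>A'\<close>
    is already diagonal.\<close>
  define P1 where "P1 = four_block_mat (1\<^sub>m 1) (0\<^sub>m 1 n) (0\<^sub>m n 1) P"
  define D1 where "D1 = four_block_mat E (0\<^sub>m 1 n) (0\<^sub>m n 1) D"
  have P1T: "transpose_mat P1 = four_block_mat (1\<^sub>m 1) (0\<^sub>m 1 n) (0\<^sub>m n 1) (transpose_mat P)"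
    unfolding P1_def using P' by (subst transpose_four_block_mat[of _ 1 1 _ n _ n]) auto
  have P1: "P1 \<in> carrier_mat ?N ?N"
    using P' four_block_carrier_mat[of "1\<^sub>m 1" 1 1 P n n] by (auto simp: P1_def)
  have D1: "D1 \<in> carrier_mat ?N ?N"
    using E D four_block_carrier_mat[of E 1 1 D n n] by (auto simp: D1_def)
  have "P1 * transpose_mat P1 = 1\<^sub>m (1 + n)"
    unfolding P1T unfolding P1_def using P' PT
    by (subst mult_four_block_mat[of _ 1 1 _ n _ n _ _ 1 _ n]) auto
  then have oP1: "real_orthogonal ?N P1" using P1 by (simp add: real_orthogonal_def)
  have "P1 * D1 = four_block_mat E (0\<^sub>m 1 n) (0\<^sub>m n 1) (P * D)"
    unfolding P1_def D1_def using P' D E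
    by (subst mult_four_block_mat[of _ 1 1 _ n _ n _ _ 1 _ n]) auto
  then have "P1 * D1 * transpose_mat P1 = four_block_mat E (0\<^sub>m 1 n) (0\<^sub>m n 1) A4"
    unfolding P1T A4eq using P' PT D E
    by (simp, subst mult_four_block_mat[of _ 1 1 _ n _ n _ _ 1 _ n]) auto
  then have A'eq: "A' = P1 * D1 * transpose_mat P1" using blk by simp
  have "A = (U * P1) * D1 * transpose_mat (U * P1)"
    using AA' U' UT P1 D1 unfolding A'eq
    by (simp add: transpose_mult[of _ ?N ?N _ ?N] assoc_mult_mat[of _ ?N ?N _ ?N _ ?N])
  moreover have "diagonal_mat D1"
    using D E unfolding diagonal_mat_def D1_def by (auto simp: E_def)
  ultimately show ?case
    using real_orthogonal_mult[OF U oP1] D1 by blast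
qed

section \<open>Orthonormal systems and spectral projections\<close>

text \<open>Cauchy--Schwarz for the Frobenius inner product, with a double sum read as one sum over
  pairs.\<close>

lemma double_sum_mult_sq_le:
  fixes a b :: "'i \<Rightarrow> 'j \<Rightarrow> real"
  shows "(\<Sum>i\<in>I. \<Sum>j\<in>J. a i j * b i j)\<^sup>2
    \<le> (\<Sum>i\<in>I. \<Sum>j\<in>J. (a i j)\<^sup>2) * (\<Sum>i\<in>I. \<Sum>j\<in>J. (b i j)\<^sup>2)"
  using Cauchy_Schwarz_ineq_sum[of "\<lambda>(i,j). a i j" "\<lambda>(i,j). b i j" "I \<times> J"]
  by (simp add: sum.cartesian_product case_prod_unfold)

text \<open>\<open>v k\<close> is the \<open>k\<close>-th vector and \<open>v k i\<close> its
  \<open>i\<close>-th coordinate. The second conjunct is the completeness relation, which makes the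
  projection onto all indices the identity.\<close>

definition orthonormal_system :: "nat \<Rightarrow> (nat \<Rightarrow> nat \<Rightarrow> real) \<Rightarrow> bool" where
  "orthonormal_system n v \<longleftrightarrow>
     (\<forall>k<n. \<forall>l<n. (\<Sum>i<n. v k i * v l i) = (if k = l then 1 else 0)) \<and>
     (\<forall>i<n. \<forall>j<n. (\<Sum>k<n. v k i * v k j) = (if i = j then 1 else 0))"

lemma orthonormal_systemD:
  assumes "orthonormal_system n v"
  shows "k < n \<Longrightarrow> l < n \<Longrightarrow> (\<Sum>i<n. v k i * v l i) = (if k = l then 1 else 0)"
    and "i < n \<Longrightarrow> j < n \<Longrightarrow> (\<Sum>k<n. v k i * v k j) = (if i = j then 1 else 0)"
  using assms by (auto simp: orthonormal_system_def)

text \<open>Besides an entry of a projection, this is the inner product of the coordinate rows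
  \<open>i\<close> and \<open>j\<close> restricted to \<open>T\<close>; that Gram reading is the one
  behind \<open>tensor_gram\<close>.\<close>

definition proj_entry :: "(nat \<Rightarrow> nat \<Rightarrow> real) \<Rightarrow> nat set \<Rightarrow> nat \<Rightarrow> nat \<Rightarrow> real" where
  "proj_entry v T i j = (\<Sum>k\<in>T. v k i * v k j)"

lemma proj_entry_inner:
  fixes M :: "nat \<Rightarrow> nat \<Rightarrow> real"
  shows "(\<Sum>i<n. \<Sum>j<n. M i j * proj_entry v T i j) = (\<Sum>k\<in>T. \<Sum>i<n. \<Sum>j<n. M i j * v k i * v k j)"
proof -
  have "(\<Sum>i<n. \<Sum>j<n. M i j * proj_entry v T i j)
      = (\<Sum>i<n. \<Sum>k\<in>T. \<Sum>j<n. M i j * v k i * v k j)"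
    unfolding proj_entry_def sum_distrib_left mult.assoc
    by (rule sum.cong[OF refl], rule sum.swap)
  also have "\<dots> = (\<Sum>k\<in>T. \<Sum>i<n. \<Sum>j<n. M i j * v k i * v k j)" by (rule sum.swap)
  finally show ?thesis .
qed

lemma proj_entry_trace:
  assumes v: "orthonormal_system n v" and T: "T \<subseteq> {..<n}"
  shows "(\<Sum>i<n. proj_entry v T i i) = card T"
proof -
  have "(\<Sum>i<n. proj_entry v T i i) = (\<Sum>k\<in>T. \<Sum>i<n. v k i * v k i)"
    unfolding proj_entry_def by (rule sum.swap)
  also have "\<dots> = (\<Sum>k\<in>T. 1)"
    using T by (intro sum.cong refl) (auto simp: orthonormal_systemD(1)[OF v])
  finally show ?thesis by simp
qed

text \<open>Expanding both factors leaves the squared inner products of \<open>v k\<close> and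
  \<open>v l\<close>, of which only those with \<open>k = l\<close> survive.\<close>

lemma proj_entry_frobenius:
  assumes v: "orthonormal_system n v" and T: "T \<subseteq> {..<n}"
  shows "(\<Sum>i<n. \<Sum>j<n. (proj_entry v T i j)\<^sup>2) = card T"
proof -
  have fin: "finite T" using T finite_subset by blast
  have "(\<Sum>i<n. \<Sum>j<n. (proj_entry v T i j)\<^sup>2)
      = (\<Sum>k\<in>T. \<Sum>i<n. \<Sum>j<n. proj_entry v T i j * v k i * v k j)"
    unfolding power2_eq_square by (rule proj_entry_inner)
  also have "\<dots> = (\<Sum>k\<in>T. 1)"
  proof (rule sum.cong[OF refl])
    fix k assume k: "k \<in> T"
    have "(\<Sum>i<n. \<Sum>j<n. proj_entry v T i j * v k i * v k j)
        = (\<Sum>i<n. \<Sum>j<n. v k i * v k j * proj_entry v T i j)"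
      by (simp add: mult_ac)
    also have "\<dots> = (\<Sum>l\<in>T. \<Sum>i<n. \<Sum>j<n. v k i * v k j * v l i * v l j)"
      by (rule proj_entry_inner)
    also have "\<dots> = (\<Sum>l\<in>T. (\<Sum>i<n. v k i * v l i) * (\<Sum>j<n. v k j * v l j))"
      unfolding sum_product by (simp add: mult_ac)
    also have "\<dots> = (\<Sum>l\<in>T. if k = l then 1 else 0)"
      by (rule sum.cong[OF refl]) (use k T in \<open>auto simp: orthonormal_systemD(1)[OF v] subset_iff\<close>)
    finally show "(\<Sum>i<n. \<Sum>j<n. proj_entry v T i j * v k i * v k j) = 1"
      using k fin by simp
  qed
  finally show ?thesis by simp
qed

lemma proj_entry_all:
  assumes "orthonormal_system n v" "i < n" "j < n"
  shows "proj_entry v {..<n} i j = (if i = j then 1 else 0)"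
  using assms by (simp add: proj_entry_def orthonormal_systemD)

text \<open>Cauchy--Schwarz for the coordinate rows \<open>i\<close> and \<open>j\<close> restricted
  to \<open>T\<close>.\<close>

lemma proj_entry_sq_le:
  "(proj_entry v T i j)\<^sup>2 \<le> proj_entry v T i i * proj_entry v T j j"
  using Cauchy_Schwarz_ineq_sum[of "\<lambda>k. v k i" "\<lambda>k. v k j" T]
  by (simp add: proj_entry_def power2_eq_square)

lemma proj_entry_diag_nonneg: "0 \<le> proj_entry v T i i"
  unfolding proj_entry_def by (rule sum_nonneg) simp

text \<open>Lets bounds on the eigenvalues \<open>d k\<close> act on the pairing of \<open>a\<close>
  with \<open>X\<close>, one quadratic form of \<open>X\<close> at a time.\<close>

lemma spectral_inner_swap:
  fixes a X v :: "nat \<Rightarrow> nat \<Rightarrow> real" and d :: "nat \<Rightarrow> real"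
  assumes dec: "\<And>i j. i < n \<Longrightarrow> j < n \<Longrightarrow> a i j = (\<Sum>k<n. d k * v k i * v k j)"
  shows "(\<Sum>i<n. \<Sum>j<n. a i j * X i j)
       = (\<Sum>k<n. d k * (\<Sum>i<n. \<Sum>j<n. X i j * v k i * v k j))"
proof -
  have "(\<Sum>i<n. \<Sum>j<n. a i j * X i j)
      = (\<Sum>i<n. \<Sum>j<n. \<Sum>k<n. d k * (X i j * v k i * v k j))"
    by (intro sum.cong refl) (simp add: dec sum_distrib_left sum_distrib_right mult_ac)
  also have "\<dots> = (\<Sum>i<n. \<Sum>k<n. \<Sum>j<n. d k * (X i j * v k i * v k j))"
    by (rule sum.cong[OF refl], rule sum.swap)
  also have "\<dots> = (\<Sum>k<n. \<Sum>i<n. \<Sum>j<n. d k * (X i j * v k i * v k j))"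
    by (rule sum.swap)
  finally show ?thesis by (simp add: sum_distrib_left)
qed

text \<open>By completeness the sum pairs \<open>X\<close> with the identity.\<close>

lemma sum_quadratic_forms_eq_trace:
  assumes v: "orthonormal_system n v"
  shows "(\<Sum>k<n. \<Sum>i<n. \<Sum>j<n. X i j * v k i * v k j) = (\<Sum>i<n. X i i)"
proof -
  have "(\<Sum>k<n. \<Sum>i<n. \<Sum>j<n. X i j * v k i * v k j)
      = (\<Sum>i<n. \<Sum>j<n. X i j * proj_entry v {..<n} i j)"
    by (rule proj_entry_inner[symmetric])
  also have "\<dots> = (\<Sum>i<n. \<Sum>j<n. if i = j then X i j else 0)"
    by (intro sum.cong refl) (simp add: proj_entry_all[OF v])
  also have "\<dots> = (\<Sum>i<n. X i i)" by simp
  finally show ?thesis .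
qed

text \<open>For the rank-one matrix \<open>x i * x j\<close> the quadratic forms at the
  \<open>v k\<close> are squares, so each \<open>d k\<close> may be raised to 1; completeness then
  returns the squared norm of \<open>x\<close>.\<close>

lemma quadratic_form_le_sum_squares:
  fixes a v :: "nat \<Rightarrow> nat \<Rightarrow> real" and d x :: "nat \<Rightarrow> real"
  assumes v: "orthonormal_system n v"
    and dec: "\<And>i j. i < n \<Longrightarrow> j < n \<Longrightarrow> a i j = (\<Sum>k<n. d k * v k i * v k j)"
    and le1: "\<And>k. k < n \<Longrightarrow> d k \<le> 1"
  shows "(\<Sum>i<n. \<Sum>j<n. a i j * (x i * x j)) \<le> (\<Sum>i<n. (x i)\<^sup>2)"
proof -
  have sq: "(\<Sum>i<n. \<Sum>j<n. x i * x j * v k i * v k j) = (\<Sum>i<n. x i * v k i)\<^sup>2" for k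
    unfolding power2_eq_square sum_product by (simp add: mult_ac)
  have "(\<Sum>i<n. \<Sum>j<n. a i j * (x i * x j))
      = (\<Sum>k<n. d k * (\<Sum>i<n. \<Sum>j<n. x i * x j * v k i * v k j))"
    by (rule spectral_inner_swap[OF dec])
  also have "\<dots> \<le> (\<Sum>k<n. \<Sum>i<n. \<Sum>j<n. x i * x j * v k i * v k j)"
    unfolding sq by (rule sum_mono) (use mult_right_mono[OF le1] in fastforce)
  also have "\<dots> = (\<Sum>i<n. x i * x i)"
    by (rule sum_quadratic_forms_eq_trace[OF v])
  finally show ?thesis by (simp add: power2_eq_square)
qed

section \<open>The tensor Gram matrix\<close>

text \<open>The Gram matrix \<open>G\<close> of the rows \<open>u\<^sub>i\<close> becomes the Gram matrix of the vectors
  \<open>u\<^sub>i \<otimes> u\<^sub>i / \<parallel>u\<^sub>i\<parallel>\<close>; for \<open>u\<^sub>i = 0\<close> the convention \<open>x / 0 = 0\<close> gives the zero vector.\<close>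

definition tensor_gram :: "(nat \<Rightarrow> nat \<Rightarrow> real) \<Rightarrow> nat set \<Rightarrow> nat \<Rightarrow> nat \<Rightarrow> real" where
  "tensor_gram w S i j = (proj_entry w S i j)\<^sup>2 /
     (sqrt (proj_entry w S i i) * sqrt (proj_entry w S j j))"

text \<open>Dividing by one power of each norm keeps the trace of the Gram matrix. For a zero row
  both sides are 0.\<close>

lemma tensor_gram_diag: "tensor_gram w S i i = proj_entry w S i i"
  using proj_entry_diag_nonneg[of w S i]
  by (simp add: tensor_gram_def power2_eq_square)

text \<open>The normalisation multiplies the Gram entry by a correlation, of modulus at most 1 by
  Cauchy--Schwarz; when \<open>?p\<close> is 0, so is the quotient by \<open>?p\<close>.\<close>

lemma tensor_gram_sq_le: "(tensor_gram w S i j)\<^sup>2 \<le> (proj_entry w S i j)\<^sup>2"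
proof -
  let ?G = "proj_entry w S i j" and ?p = "proj_entry w S i i * proj_entry w S j j"
  have p: "0 \<le> ?p" by (simp add: proj_entry_diag_nonneg)
  have "(tensor_gram w S i j)\<^sup>2 = (?G\<^sup>2)\<^sup>2 / ?p"
    by (simp add: tensor_gram_def power_divide power_mult_distrib proj_entry_diag_nonneg)
  also have "\<dots> = ?G\<^sup>2 * (?G\<^sup>2 / ?p)" by (simp add: power2_eq_square)
  also have "\<dots> \<le> ?G\<^sup>2 * 1"
    by (intro mult_left_mono divide_le_eq_1[THEN iffD2])
       (use proj_entry_sq_le[of w S i j] p in \<open>auto simp: less_le\<close>)
  finally show ?thesis by simp
qed

lemma sum_swap_pairs:
  "(\<Sum>i\<in>I. \<Sum>j\<in>J. \<Sum>k\<in>K. \<Sum>l\<in>L. f i j k l)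
     = (\<Sum>k\<in>K. \<Sum>l\<in>L. \<Sum>i\<in>I. \<Sum>j\<in>J. f i j k l)"
proof -
  have "(\<Sum>i\<in>I. \<Sum>j\<in>J. \<Sum>k\<in>K. \<Sum>l\<in>L. f i j k l)
      = (\<Sum>i\<in>I. \<Sum>k\<in>K. \<Sum>j\<in>J. \<Sum>l\<in>L. f i j k l)"
    by (rule sum.cong[OF refl], rule sum.swap)
  also have "\<dots> = (\<Sum>k\<in>K. \<Sum>i\<in>I. \<Sum>j\<in>J. \<Sum>l\<in>L. f i j k l)"
    by (rule sum.swap)
  also have "\<dots> = (\<Sum>k\<in>K. \<Sum>i\<in>I. \<Sum>l\<in>L. \<Sum>j\<in>J. f i j k l)"
    by (rule sum.cong[OF refl], rule sum.cong[OF refl], rule sum.swap)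
  also have "\<dots> = (\<Sum>k\<in>K. \<Sum>l\<in>L. \<Sum>i\<in>I. \<Sum>j\<in>J. f i j k l)"
    by (rule sum.cong[OF refl], rule sum.swap)
  finally show ?thesis .
qed

text \<open>As for any Gram matrix, the form is a squared norm: one square for each tensor
  coordinate \<open>(k, l)\<close>.\<close>

lemma tensor_gram_quadratic_form_nonneg:
  fixes x :: "nat \<Rightarrow> real"
  shows "0 \<le> (\<Sum>i<n. \<Sum>j<n. tensor_gram w S i j * x i * x j)"
proof -
  define g where "g i = sqrt (proj_entry w S i i)" for i
  have "(\<Sum>i<n. \<Sum>j<n. tensor_gram w S i j * x i * x j)
      = (\<Sum>i<n. \<Sum>j<n. \<Sum>k\<in>S. \<Sum>l\<in>S. (x i * w k i * w l i / g i) * (x j * w k j * w l j / g j))"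
    unfolding tensor_gram_def g_def[symmetric]
    by (simp add: power2_eq_square proj_entry_def sum_product
         sum_distrib_right sum_distrib_left sum_divide_distrib mult_ac)
  also have "\<dots> = (\<Sum>k\<in>S. \<Sum>l\<in>S. \<Sum>i<n. \<Sum>j<n.
      (x i * w k i * w l i / g i) * (x j * w k j * w l j / g j))"
    by (rule sum_swap_pairs)
  also have "\<dots> = (\<Sum>k\<in>S. \<Sum>l\<in>S. (\<Sum>i<n. x i * w k i * w l i / g i)\<^sup>2)"
    unfolding power2_eq_square sum_product ..
  also have "\<dots> \<ge> 0" by (intro sum_nonneg) auto
  finally show ?thesis .
qed

lemma tensor_gram_correlation:
  fixes a b v w :: "nat \<Rightarrow> nat \<Rightarrow> real" and d e :: "nat \<Rightarrow> real"
  assumes v: "orthonormal_system n v" and w: "orthonormal_system n w"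
    and dec_a: "\<And>i j. i < n \<Longrightarrow> j < n \<Longrightarrow> a i j = (\<Sum>k<n. d k * v k i * v k j)"
    and dec_b: "\<And>i j. i < n \<Longrightarrow> j < n \<Longrightarrow> b i j = (\<Sum>k<n. e k * w k i * w k j)"
    and le1: "\<And>k. k < n \<Longrightarrow> d k \<le> 1"
    and ba: "\<And>i j. i < n \<Longrightarrow> j < n \<Longrightarrow> \<bar>b i j\<bar> \<le> a i j"
    and S: "S \<subseteq> {..<n}" "S \<noteq> {}" and lam: "0 \<le> \<mu>" "\<And>k. k \<in> S \<Longrightarrow> \<mu> \<le> e k"
  shows "\<mu>\<^sup>2 * card S \<le> (\<Sum>i<n. \<Sum>j<n. a i j * tensor_gram w S i j)"
proof -
  define g where "g i = sqrt (proj_entry w S i i)" for i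
  define m :: real where "m = card S"
  have finS: "finite S" using S finite_subset by blast
  then have m: "0 < m" using S by (simp add: m_def card_gt_0_iff)
  have a0: "0 \<le> a i j" if "i < n" "j < n" for i j using ba[OF that] by linarith
  have g0: "0 \<le> g i" for i by (simp add: g_def proj_entry_diag_nonneg)
  have g2: "(g i)\<^sup>2 = proj_entry w S i i" for i by (simp add: g_def proj_entry_diag_nonneg)
  have Gg: "\<bar>proj_entry w S i j\<bar> \<le> g i * g j" for i j
    using real_le_rsqrt[OF order.trans[OF eq_refl proj_entry_sq_le[of w S i j]], of "\<bar>proj_entry w S i j\<bar>"]
    by (simp add: g_def real_sqrt_mult)
  \<comment> \<open>Pairing \<open>b\<close> with the rank-one projection onto \<open>w k\<close>
    isolates its eigenvalue, since the other eigenvectors are orthogonal to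
    \<open>w k\<close>.\<close>
  have form: "(\<Sum>i<n. \<Sum>j<n. b i j * w k i * w k j) = e k" if "k < n" for k
  proof -
    have "(\<Sum>i<n. \<Sum>j<n. b i j * (w k i * w k j))
        = (\<Sum>l<n. e l * (\<Sum>i<n. \<Sum>j<n. w k i * w k j * w l i * w l j))"
      by (rule spectral_inner_swap[OF dec_b])
    also have "\<dots> = (\<Sum>l<n. e l * ((\<Sum>i<n. w k i * w l i) * (\<Sum>j<n. w k j * w l j)))"
      unfolding sum_product by (simp add: mult_ac)
    also have "\<dots> = (\<Sum>l<n. if k = l then e l else 0)"
      using that by (intro sum.cong refl) (simp add: orthonormal_systemD(1)[OF w])
    finally show ?thesis using that by (simp add: mult.assoc)
  qed
  have "\<mu> * m \<le> (\<Sum>k\<in>S. e k)"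
    using sum_mono[of S "\<lambda>_. \<mu>" e] lam by (simp add: m_def mult.commute)
  also have "\<dots> = (\<Sum>k\<in>S. \<Sum>i<n. \<Sum>j<n. b i j * w k i * w k j)"
    using S by (intro sum.cong refl form[symmetric]) auto
  also have "\<dots> = (\<Sum>i<n. \<Sum>j<n. b i j * proj_entry w S i j)"
    by (rule proj_entry_inner[symmetric])
  also have "\<dots> \<le> (\<Sum>i<n. \<Sum>j<n. a i j * \<bar>proj_entry w S i j\<bar>)"
  proof (intro sum_mono)
    fix i j assume "i \<in> {..<n}" "j \<in> {..<n}"
    then have "\<bar>b i j * proj_entry w S i j\<bar> \<le> a i j * \<bar>proj_entry w S i j\<bar>"
      unfolding abs_mult by (intro mult_right_mono ba) auto
    then show "b i j * proj_entry w S i j \<le> a i j * \<bar>proj_entry w S i j\<bar>" by linarith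
  qed
  finally have lower: "\<mu> * m \<le> (\<Sum>i<n. \<Sum>j<n. a i j * \<bar>proj_entry w S i j\<bar>)" .
  \<comment> \<open>Cauchy--Schwarz with weights \<open>a i j\<close>, arranged so that one factor is the tensor Gram matrix\<close>
  have split: "a i j * \<bar>proj_entry w S i j\<bar>
      = sqrt (a i j * (g i * g j)) * sqrt (a i j * tensor_gram w S i j)"
    if "i < n" "j < n" for i j
  proof (cases "g i * g j = 0")
    \<comment> \<open>If one of the two rows is zero, \<open>Gg\<close> forces the Gram entry to
      vanish, so both sides are 0.\<close>
    case True
    then show ?thesis using Gg[of i j] by auto
  next
    case False
    have "a i j * (g i * g j) * (a i j * tensor_gram w S i j) = (a i j * \<bar>proj_entry w S i j\<bar>)\<^sup>2"
      using False by (simp add: tensor_gram_def power_mult_distrib power2_eq_square flip: g_def)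
    then show ?thesis using a0[OF that] by (simp flip: real_sqrt_mult)
  qed
  have t0: "0 \<le> tensor_gram w S i j" for i j
    by (simp add: tensor_gram_def proj_entry_diag_nonneg)
  have "(\<Sum>i<n. \<Sum>j<n. a i j * \<bar>proj_entry w S i j\<bar>)\<^sup>2
      = (\<Sum>i<n. \<Sum>j<n. sqrt (a i j * (g i * g j)) * sqrt (a i j * tensor_gram w S i j))\<^sup>2"
    by (simp add: split)
  also have "\<dots> \<le> (\<Sum>i<n. \<Sum>j<n. (sqrt (a i j * (g i * g j)))\<^sup>2)
                 * (\<Sum>i<n. \<Sum>j<n. (sqrt (a i j * tensor_gram w S i j))\<^sup>2)"
    by (rule double_sum_mult_sq_le)
  also have "\<dots> = (\<Sum>i<n. \<Sum>j<n. a i j * (g i * g j))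
                 * (\<Sum>i<n. \<Sum>j<n. a i j * tensor_gram w S i j)"
    by (simp add: a0 g0 t0)
  also have "\<dots> \<le> m * (\<Sum>i<n. \<Sum>j<n. a i j * tensor_gram w S i j)"
  proof (rule mult_right_mono)
    \<comment> \<open>The bound \<open>d k \<le> 1\<close> is applied to the vector of row norms
      \<open>g\<close>, whose squared length is the trace \<open>m\<close>.\<close>
    have "(\<Sum>i<n. \<Sum>j<n. a i j * (g i * g j)) \<le> (\<Sum>i<n. (g i)\<^sup>2)"
      by (rule quadratic_form_le_sum_squares[OF v dec_a le1])
    also have "\<dots> = m" by (simp add: g2 m_def proj_entry_trace[OF w S(1)])
    finally show "(\<Sum>i<n. \<Sum>j<n. a i j * (g i * g j)) \<le> m" .
  qed (auto intro!: sum_nonneg simp: a0 t0)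
  finally have "(\<mu> * m)\<^sup>2 \<le> m * (\<Sum>i<n. \<Sum>j<n. a i j * tensor_gram w S i j)"
    using power_mono[OF lower, of 2] lam m by simp
  then have "m * (\<mu>\<^sup>2 * m) \<le> m * (\<Sum>i<n. \<Sum>j<n. a i j * tensor_gram w S i j)"
    by (simp add: power_mult_distrib power2_eq_square mult_ac)
  then show ?thesis using m by (simp add: m_def)
qed

section \<open>Comparison of eigenvalue counts from spectral data\<close>

lemma count_eigenvalues_bound:
  fixes a b v w :: "nat \<Rightarrow> nat \<Rightarrow> real" and d e :: "nat \<Rightarrow> real"
  assumes v: "orthonormal_system n v" and w: "orthonormal_system n w"
    and dec_a: "\<And>i j. i < n \<Longrightarrow> j < n \<Longrightarrow> a i j = (\<Sum>k<n. d k * v k i * v k j)"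
    and dec_b: "\<And>i j. i < n \<Longrightarrow> j < n \<Longrightarrow> b i j = (\<Sum>k<n. e k * w k i * w k j)"
    and le1: "\<And>k. k < n \<Longrightarrow> d k \<le> 1"
    and ba: "\<And>i j. i < n \<Longrightarrow> j < n \<Longrightarrow> \<bar>b i j\<bar> \<le> a i j"
    and tau: "0 < \<tau>" "\<tau> < 1" and sigma: "0 < \<sigma>"
  shows "\<sigma>\<^sup>2 * card {k. k < n \<and> sqrt (\<tau> * (1 - \<sigma>) + \<sigma>) \<le> e k} \<le> card {k. k < n \<and> \<tau> \<le> d k}"
proof -
  define \<mu> where "\<mu> = sqrt (\<tau> * (1 - \<sigma>) + \<sigma>)"
  define S where "S = {k. k < n \<and> \<mu> \<le> e k}"
  define T where "T = {k. k < n \<and> \<tau> \<le> d k}"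
  define m :: real where "m = card S"
  have S: "S \<subseteq> {..<n}" and T: "T \<subseteq> {..<n}" by (auto simp: S_def T_def)
  show ?thesis
  proof (cases "S = {}")
    case True
    then show ?thesis unfolding S_def \<mu>_def by (simp only: card.empty)
  next
    case False
    \<comment> \<open>This form shows the radicand to be nonnegative even for
      \<open>\<sigma> > 1\<close>, so squaring \<open>\<mu>\<close> undoes the root.\<close>
    have "\<tau> * (1 - \<sigma>) + \<sigma> = \<tau> + \<sigma> * (1 - \<tau>)" by (simp add: algebra_simps)
    moreover have "0 \<le> \<tau> + \<sigma> * (1 - \<tau>)" using tau sigma by simp
    ultimately have lam: "0 \<le> \<mu>" "\<mu>\<^sup>2 = \<tau> + \<sigma> * (1 - \<tau>)" by (simp_all add: \<mu>_def)
    have m: "0 < m" using False S by (simp add: m_def card_gt_0_iff finite_subset)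
    \<comment> \<open>The \<open>q k\<close> are nonnegative weights of total mass \<open>m\<close>
      on the eigenvectors of \<open>a\<close>, and \<open>t\<close> is the mass on \<open>T\<close>.
      The aim is to show that \<open>t\<close> is large.\<close>
    define q where "q k = (\<Sum>i<n. \<Sum>j<n. tensor_gram w S i j * v k i * v k j)" for k
    define t where "t = sum q T"
    have q0: "0 \<le> q k" for k unfolding q_def by (rule tensor_gram_quadratic_form_nonneg)
    have qm: "sum q {..<n} = m"
      by (simp add: q_def sum_quadratic_forms_eq_trace[OF v] tensor_gram_diag
          proj_entry_trace[OF w S] m_def)
    have "\<mu>\<^sup>2 * m \<le> (\<Sum>i<n. \<Sum>j<n. a i j * tensor_gram w S i j)"
      unfolding m_def
      by (rule tensor_gram_correlation[OF v w dec_a dec_b le1 ba S False lam(1)])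
         (auto simp: S_def)
    also have "\<dots> = (\<Sum>k<n. d k * q k)"
      unfolding q_def by (rule spectral_inner_swap[OF dec_a])
    \<comment> \<open>Eigenvalues indexed by \<open>T\<close> are raised to 1 and all others to
      \<open>\<tau>\<close>.\<close>
    also have "\<dots> \<le> (\<Sum>k<n. \<tau> * q k + (if k \<in> T then (1 - \<tau>) * q k else 0))"
    proof (rule sum_mono)
      fix k assume k: "k \<in> {..<n}"
      have "d k \<le> (if k \<in> T then 1 else \<tau>)" using k le1 by (auto simp: T_def)
      from mult_right_mono[OF this q0[of k]]
      show "d k * q k \<le> \<tau> * q k + (if k \<in> T then (1 - \<tau>) * q k else 0)"
        by (auto simp: algebra_simps)
    qed
    also have "\<dots> = \<tau> * m + (1 - \<tau>) * t"
      using T by (simp add: sum.distrib t_def qm sum.If_cases Int_absorb1 flip: sum_distrib_left)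
    \<comment> \<open>The threshold is chosen for this line: once \<open>\<tau> * m\<close> cancels,
      both sides carry the factor \<open>1 - \<tau>\<close>.\<close>
    finally have "(1 - \<tau>) * (\<sigma> * m) \<le> (1 - \<tau>) * t" unfolding lam(2) by (simp add: algebra_simps)
    then have "\<sigma> * m \<le> t" using tau by simp
    then have "(\<sigma> * m)\<^sup>2 \<le> t\<^sup>2" using sigma m by (intro power_mono) auto
    also have "t = (\<Sum>i<n. \<Sum>j<n. tensor_gram w S i j * proj_entry v T i j)"
      unfolding t_def q_def by (rule proj_entry_inner[symmetric])
    also have "\<dots>\<^sup>2 \<le> (\<Sum>i<n. \<Sum>j<n. (tensor_gram w S i j)\<^sup>2)
                   * (\<Sum>i<n. \<Sum>j<n. (proj_entry v T i j)\<^sup>2)"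
      by (rule double_sum_mult_sq_le)
    \<comment> \<open>The Frobenius bound is linear in \<open>m\<close> while the left side is
      quadratic, so one factor \<open>m\<close> survives the division below.\<close>
    also have "\<dots> \<le> (\<Sum>i<n. \<Sum>j<n. (proj_entry w S i j)\<^sup>2) * card T"
      unfolding proj_entry_frobenius[OF v T]
      by (intro mult_right_mono sum_mono tensor_gram_sq_le) simp
    also have "\<dots> = m * card T" by (simp add: proj_entry_frobenius[OF w S] m_def)
    finally have "m * (\<sigma>\<^sup>2 * m) \<le> m * card T"
      by (simp add: power_mult_distrib power2_eq_square mult_ac)
    then show ?thesis using m by (simp add: m_def S_def T_def \<mu>_def)
  qed
qed

section \<open>Eigenvalue counts of matrices\<close>

lemma order_prod_linear_factors:
  fixes d :: "nat \<Rightarrow> real"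
  shows "order x (\<Prod>k<n. [:- d k, 1:]) = card {k. k < n \<and> d k = x}"
proof (induction n)
  case 0
  then show ?case by (simp add: order_0I)
next
  case (Suc n)
  have nz: "(\<Prod>k<Suc n. [:- d k, 1:]) \<noteq> 0" by (subst prod_zero_iff) auto
  have "{k. k < Suc n \<and> d k = x} = {k. k < n \<and> d k = x} \<union> (if d n = x then {n} else {})"
    by (auto simp: less_Suc_eq)
  then have "card {k. k < Suc n \<and> d k = x} = card {k. k < n \<and> d k = x} + (if d n = x then 1 else 0)"
    by simp
  moreover have "order x [:- d n, 1:] = (if d n = x then 1 else 0)"
    using order_power_n_n[of x 1] by (auto intro!: order_0I)
  moreover have "order x (\<Prod>k<Suc n. [:- d k, 1:])
      = order x (\<Prod>k<n. [:- d k, 1:]) + order x [:- d n, 1:]"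
    using nz by (subst prod.lessThan_Suc, subst order_mult) (simp_all add: mult.commute)
  ultimately show ?case using Suc.IH by simp
qed

text \<open>The multiplicity of \<open>x\<close> is the size of the fibre of \<open>d\<close> over
  \<open>x\<close>, and these fibres partition the index set.\<close>

lemma rank_ge_eq_card:
  assumes A: "A \<in> carrier_mat n n" and cp: "char_poly A = (\<Prod>k<n. [:- d k, 1:])"
  shows "rank_ge l A = card {k. k < n \<and> l \<le> d k}"
proof -
  let ?E = "{x. eigenvalue A x \<and> l \<le> x}"
  have E: "?E = d ` {k. k < n \<and> l \<le> d k}"
    by (auto simp: eigenvalue_root_char_poly[OF A] cp poly_prod)
  have "rank_ge l A = (\<Sum>x\<in>?E. card {k. k < n \<and> d k = x})"
    by (simp add: rank_ge_def cp order_prod_linear_factors)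
  also have "\<dots> = card (\<Union>x\<in>?E. {k. k < n \<and> d k = x})"
    by (rule card_UN_disjoint[symmetric]) (auto simp: finite_eigenvalues_ge[OF A])
  also have "(\<Union>x\<in>?E. {k. k < n \<and> d k = x}) = {k. k < n \<and> l \<le> d k}"
    unfolding E by auto
  finally show ?thesis .
qed

text \<open>The \<open>v k\<close> are the columns of \<open>P\<close> and the \<open>d k\<close>
  the diagonal of \<open>D\<close>. Similarity to \<open>D\<close> makes the list of
  \<open>d k\<close> record algebraic multiplicities.\<close>

lemma symmetric_real_spectral_sum:
  fixes A :: "real mat"
  assumes A: "A \<in> carrier_mat n n" "transpose_mat A = A"
  obtains v d where "orthonormal_system n v"
    "\<And>i j. i < n \<Longrightarrow> j < n \<Longrightarrow> A $$ (i,j) = (\<Sum>k<n. d k * v k i * v k j)"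
    "char_poly A = (\<Prod>k<n. [:- d k, 1:])"
proof -
  obtain P D where P: "real_orthogonal n P" and D: "D \<in> carrier_mat n n" "diagonal_mat D"
    and Aeq: "A = P * D * transpose_mat P"
    using symmetric_real_spectral_decomposition[OF A] by blast
  note P' = real_orthogonalD[OF P]
  have PT: "transpose_mat P \<in> carrier_mat n n" using P' by auto
  define v where "v k i = P $$ (i,k)" for k i
  define d where "d k = D $$ (k,k)" for k
  have "orthonormal_system n v"
    unfolding orthonormal_system_def
  proof (intro conjI allI impI)
    fix k l assume "k < n" "l < n"
    then show "(\<Sum>i<n. v k i * v l i) = (if k = l then 1 else 0)"
      using arg_cong[OF P'(3), of "\<lambda>M. M $$ (k,l)"] P'(1)
      by (simp add: v_def scalar_prod_def atLeast0LessThan)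
  next
    fix i j assume "i < n" "j < n"
    then show "(\<Sum>k<n. v k i * v k j) = (if i = j then 1 else 0)"
      using arg_cong[OF P'(2), of "\<lambda>M. M $$ (i,j)"] P'(1)
      by (simp add: v_def scalar_prod_def atLeast0LessThan)
  qed
  moreover have "A $$ (i,j) = (\<Sum>k<n. d k * v k i * v k j)" if ij: "i < n" "j < n" for i j
  proof -
    have PD: "(P * D) $$ (i,k) = v k i * d k" if k: "k < n" for k
    proof -
      have "(P * D) $$ (i,k) = (\<Sum>l<n. P $$ (i,l) * D $$ (l,k))"
        using ij k P'(1) D by (simp add: scalar_prod_def atLeast0LessThan)
      also have "\<dots> = (\<Sum>l<n. if l = k then P $$ (i,k) * D $$ (k,k) else 0)"
        using D k by (intro sum.cong) (auto simp: diagonal_mat_def)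
      finally show ?thesis using k by (simp add: v_def d_def)
    qed
    have multT: "(M * transpose_mat P) $$ (i,j) = (\<Sum>k<n. M $$ (i,k) * P $$ (j,k))"
      if "M \<in> carrier_mat n n" for M
      using that ij P'(1) by (simp add: scalar_prod_def atLeast0LessThan)
    have "A $$ (i,j) = (\<Sum>k<n. (P * D) $$ (i,k) * P $$ (j,k))"
      unfolding Aeq by (rule multT) (use P'(1) D in auto)
    also have "\<dots> = (\<Sum>k<n. d k * v k i * v k j)"
      by (intro sum.cong) (auto simp: PD v_def mult_ac)
    finally show ?thesis .
  qed
  moreover have "char_poly A = (\<Prod>k<n. [:- d k, 1:])"
  proof -
    have "similar_mat A D"
      using A(1) D P' PT Aeq by (intro similar_matI[of _ _ P "transpose_mat P" n]) auto
    then have "char_poly A = char_poly D" by (rule char_poly_similar)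
    also have "\<dots> = (\<Prod>a\<leftarrow>diag_mat D. [:- a, 1:])"
      using D by (intro char_poly_upper_triangular[OF D(1)])
        (auto simp: diagonal_mat_def upper_triangular_def)
    also have "\<dots> = (\<Prod>k<n. [:- d k, 1:])"
      using D by (simp add: diag_mat_def d_def prod.list_conv_set_nth atLeast0LessThan)
    finally show ?thesis .
  qed
  ultimately show ?thesis by (rule that)
qed

text \<open>The unit eigenvector \<open>v k\<close> competes in the supremum and contributes the
  modulus of \<open>d k\<close>.\<close>

lemma spectral_value_le_op_norm:
  fixes A :: "real mat"
  assumes A: "A \<in> carrier_mat n n" and v: "orthonormal_system n v"
    and dec: "\<And>i j. i < n \<Longrightarrow> j < n \<Longrightarrow> A $$ (i,j) = (\<Sum>k<n. d k * v k i * v k j)"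
    and k: "k < n"
  shows "d k \<le> op_norm A"
proof -
  define x where "x = vec n (v k)"
  have x: "x \<in> carrier_vec n" by (simp add: x_def)
  have xx: "scalar_prod x x = 1"
    using orthonormal_systemD(1)[OF v k k] by (simp add: x_def scalar_prod_def atLeast0LessThan)
  have Ax: "A *\<^sub>v x = d k \<cdot>\<^sub>v x"
  proof (rule eq_vecI)
    fix i assume "i < dim_vec (d k \<cdot>\<^sub>v x)"
    then have i: "i < n" using x by simp
    have "(A *\<^sub>v x) $ i = (\<Sum>j<n. \<Sum>l<n. d l * v l i * v l j * v k j)"
      using i A by (simp add: x_def scalar_prod_def atLeast0LessThan dec sum_distrib_right)
    also have "\<dots> = (\<Sum>l<n. d l * v l i * (\<Sum>j<n. v l j * v k j))"
      by (subst sum.swap) (simp add: sum_distrib_left mult.assoc)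
    also have "\<dots> = (\<Sum>l<n. if l = k then d l * v l i else 0)"
      using k by (intro sum.cong refl) (simp add: orthonormal_systemD(1)[OF v])
    finally show "(A *\<^sub>v x) $ i = (d k \<cdot>\<^sub>v x) $ i" using i k by (simp add: x_def)
  qed (use A x in auto)
  have "vec_l2norm (A *\<^sub>v x) \<le> op_norm A"
    unfolding op_norm_def
    by (rule cSup_upper[OF _ bdd_above_op_norm]) (use A x xx in \<open>auto simp: vec_l2norm_def\<close>)
  moreover have "vec_l2norm (A *\<^sub>v x) = \<bar>d k\<bar>"
    using x xx by (simp add: Ax vec_l2norm_def)
  ultimately show ?thesis by linarith
qed

theorem theorem4p1:
  fixes A B :: "real mat" and n :: nat and s \<tau> \<sigma> :: real
  assumes A: "A \<in> carrier_mat n n" "transpose_mat A = A"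
    and A_nonneg: "\<And>i j. i < n \<Longrightarrow> j < n \<Longrightarrow> 0 \<le> A $$ (i, j)"
    and A_norm: "op_norm A \<le> 1"
    and B: "B \<in> carrier_mat n n" "transpose_mat B = B"
    and B_le_A: "\<And>i j. i < n \<Longrightarrow> j < n \<Longrightarrow> \<bar>B $$ (i, j)\<bar> \<le> A $$ (i, j)"
    and tau: "0 < \<tau>" "\<tau> < 1"
    and rank_A: "real (rank_ge \<tau> A) \<le> s"
    and sigma: "0 < \<sigma>"
  shows "real (rank_ge (sqrt (\<tau> * (1 - \<sigma>) + \<sigma>)) B) \<le> s / \<sigma>\<^sup>2"
proof -
  obtain v d where v: "orthonormal_system n v"
    and dec_A: "\<And>i j. i < n \<Longrightarrow> j < n \<Longrightarrow> A $$ (i,j) = (\<Sum>k<n. d k * v k i * v k j)"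
    and cp_A: "char_poly A = (\<Prod>k<n. [:- d k, 1:])"
    using symmetric_real_spectral_sum[OF A] by blast
  obtain w e where w: "orthonormal_system n w"
    and dec_B: "\<And>i j. i < n \<Longrightarrow> j < n \<Longrightarrow> B $$ (i,j) = (\<Sum>k<n. e k * w k i * w k j)"
    and cp_B: "char_poly B = (\<Prod>k<n. [:- e k, 1:])"
    using symmetric_real_spectral_sum[OF B] by blast
  \<comment> \<open>The norm hypothesis enters as an upper bound on every eigenvalue of
    \<open>A\<close>.\<close>
  have le1: "d k \<le> 1" if "k < n" for k
    using spectral_value_le_op_norm[OF A(1) v dec_A that] A_norm by linarith
  have "\<sigma>\<^sup>2 * rank_ge (sqrt (\<tau> * (1 - \<sigma>) + \<sigma>)) B \<le> rank_ge \<tau> A"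
    unfolding rank_ge_eq_card[OF A(1) cp_A] rank_ge_eq_card[OF B(1) cp_B]
    by (rule count_eigenvalues_bound[where a = "\<lambda>i j. A $$ (i,j)" and b = "\<lambda>i j. B $$ (i,j)",
          OF v w dec_A dec_B le1 B_le_A tau sigma])
  with rank_A have "\<sigma>\<^sup>2 * rank_ge (sqrt (\<tau> * (1 - \<sigma>) + \<sigma>)) B \<le> s" by linarith
  then show ?thesis using sigma by (simp add: pos_le_divide_eq mult.commute)
qed

end
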